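(* Let $(X,\wp)$ be a consistency space in which every element has a negation, and let $t,x,y,z\in X$. If $t\to x$ and $t\to y$, and if $\{x,y\}\sim\{z\}$, then $t\to z$.
   Context: A consistency space $(X,\wp)$ consists of a nonempty set $X$ and a nonempty collection $\wp$ of subsets of $X$ such that (1) $X\notin\wp$, and (2) if $A\in\wp$ and $B\subseteq A$, then $B\in\wp$. For $A,B\subseteq X$, write $A\sim B$ if for every $C\subseteq X$, $A\cup C\in\wp$ if and only if $B\cup C\in\wp$. A negation of $x\in X$ is any element $\bar{x}\in X$ satisfying: (1) $\{x,\bar{x}\}\notin\wp$; (2) for all $z\in X$, if $\{x,z\}\notin\wp$ then $\{\bar{x},z\}\sim\{z\}$; (3) for all $z\in X$, if $\{\bar{x},z\}\notin\wp$ then $\{x,z\}\sim\{z\}$. For each $x\in X$, $\bar{x}$ denotes an (arbitrary but fixed) negation of $x$. For $x,y\in X$, write $x\to y$ if and only if $\{x,\bar{y}\}\notin\wp$. *)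

theory Defs
  imports Main
begin

text \<open>Here \<open>K\<close> is the collection of consistent subsets of \<open>X\<close>.\<close>

locale consistency_space =
  fixes X :: "'a set" and K :: "'a set set"
  assumes carrier_nonempty: "X \<noteq> {}"
    and consistent_nonempty: "K \<noteq> {}"
    and consistent_subset: "K \<subseteq> Pow X"
    and carrier_inconsistent: "X \<notin> K"
    and subset_closed: "\<And>A B. A \<in> K \<Longrightarrow> B \<subseteq> A \<Longrightarrow> B \<in> K"

text \<open>The relation is only meant to be used for \<open>A\<close> and \<open>B\<close> contained in \<open>X\<close>.\<close>

definition cequiv :: "'a set \<Rightarrow> 'a set set \<Rightarrow> 'a set \<Rightarrow> 'a set \<Rightarrow> bool" where
  "cequiv X K A B \<longleftrightarrow> (\<forall>C. C \<subseteq> X \<longrightarrow> (A \<union> C \<in> K \<longleftrightarrow> B \<union> C \<in> K))"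

definition is_negation :: "'a set \<Rightarrow> 'a set set \<Rightarrow> 'a \<Rightarrow> 'a \<Rightarrow> bool" where
  "is_negation X K x x' \<longleftrightarrow>
     x' \<in> X \<and>
     {x, x'} \<notin> K \<and>
     (\<forall>z\<in>X. {x, z} \<notin> K \<longrightarrow> cequiv X K {x', z} {z}) \<and>
     (\<forall>z\<in>X. {x', z} \<notin> K \<longrightarrow> cequiv X K {x, z} {z})"

text \<open>Negations need not be unique, so \<open>neg\<close> is an arbitrary choice of one negation for each
  element of \<open>X\<close>; its existence says that every element of \<open>X\<close> has a negation.\<close>

definition negation_choice :: "'a set \<Rightarrow> 'a set set \<Rightarrow> ('a \<Rightarrow> 'a) \<Rightarrow> bool" where
  "negation_choice X K neg \<longleftrightarrow> (\<forall>x\<in>X. is_negation X K x (neg x))"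

definition cimplies :: "'a set set \<Rightarrow> ('a \<Rightarrow> 'a) \<Rightarrow> 'a \<Rightarrow> 'a \<Rightarrow> bool" where
  "cimplies K neg x y \<longleftrightarrow> {x, neg y} \<notin> K"

end

theory Submission
  imports Defs
begin

text \<open>If \<open>t \<rightarrow> x\<close>, then \<open>x\<close> can be adjoined to any consistent set containing \<open>t\<close> without losing
  consistency. So if \<open>t\<close> were consistent with the negation of \<open>z\<close>, both \<open>x\<close> and \<open>y\<close> could be
  adjoined to that pair. As \<open>{x, y} \<sim> {z}\<close>, trading \<open>x\<close> and \<open>y\<close> for \<open>z\<close> would then make \<open>z\<close>
  consistent with its own negation.\<close>

lemma cequivD:
  assumes "cequiv X K A B" and "C \<subseteq> X"
  shows "A \<union> C \<in> K \<longleftrightarrow> B \<union> C \<in> K"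
  using assms unfolding cequiv_def by blast

lemma negation_choice_cequiv:
  assumes "negation_choice X K neg" and "x \<in> X" "t \<in> X" "{neg x, t} \<notin> K"
  shows "cequiv X K {x, t} {t}"
  using assms unfolding negation_choice_def is_negation_def by blast

text \<open>Since \<open>t\<close> is inconsistent with the negation of \<open>x\<close>, the third condition on a negation gives
  \<open>{x, t} \<sim> {t}\<close>. The point of the relation \<open>\<sim>\<close> is that this holds in every context \<open>C\<close>,
  which allows several consequences of \<open>t\<close> to be adjoined one after the other.\<close>

lemma consistent_insert_consequence:
  assumes neg: "negation_choice X K neg"
    and "t \<in> X" "x \<in> X" "cimplies K neg t x"
    and "C \<subseteq> X" "insert t C \<in> K"
  shows "insert x (insert t C) \<in> K"
proof -
  have "{neg x, t} \<notin> K"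
    using assms(4) by (simp add: cimplies_def insert_commute)
  then have "cequiv X K {x, t} {t}"
    by (rule negation_choice_cequiv[OF neg assms(3,2)])
  then have "{x, t} \<union> C \<in> K \<longleftrightarrow> {t} \<union> C \<in> K"
    using assms(5) by (rule cequivD)
  then show ?thesis
    using assms(6) by simp
qed

theorem proposition11:
  fixes X :: "'a set" and K :: "'a set set" and neg :: "'a \<Rightarrow> 'a" and t x y z :: 'a
  assumes "consistency_space X K"
    and "negation_choice X K neg"
    and "t \<in> X" and "x \<in> X" and "y \<in> X" and "z \<in> X"
    and "cimplies K neg t x"
    and "cimplies K neg t y"
    and "cequiv X K {x, y} {z}"
  shows "cimplies K neg t z"
proof (rule ccontr)
  have neg_z: "neg z \<in> X" "{z, neg z} \<notin> K"
    using assms(2,6) unfolding negation_choice_def is_negation_def by blast+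
  assume "\<not> cimplies K neg t z"
  then have "insert t {neg z} \<in> K"
    by (simp add: cimplies_def)
  then have "insert y (insert t {neg z}) \<in> K"
    using neg_z(1) by (intro consistent_insert_consequence[OF assms(2,3,5,8)]) simp_all
  then have "insert t {y, neg z} \<in> K"
    by (simp add: insert_commute)
  then have "insert x (insert t {y, neg z}) \<in> K"
    using assms(5) neg_z(1) by (intro consistent_insert_consequence[OF assms(2,3,4,7)]) simp_all
  then have "{x, y} \<union> {t, neg z} \<in> K"
    by (simp add: insert_commute)
  then have "{z} \<union> {t, neg z} \<in> K"
    using cequivD[OF assms(9), of "{t, neg z}"] assms(3) neg_z(1) by simp
  then have "{z, neg z} \<in> K"
    by (rule consistency_space.subset_closed[OF assms(1)]) auto
  then show False
    using neg_z(2) by contradiction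
qed

end
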